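(* For any $d\in\mathbb{N}_0$, $$t^{\star}(2,\{1\}^d,2)=-\frac{2}{\pi}\sum_{r=1}^{d+1}2^r\sum_{\substack{s_1+\cdots+s_r=d+1\\ s_1,\ldots,s_r\geq1}}t(s_1+2,s_2,\ldots,s_{r-1},\overline{s_r+2}),$$ where for $r=1$ the inner sum is the single value $t(\overline{d+5})$.
   Context: $t^{\star}(\boldsymbol{s})=\sum_{k_1\geq\cdots\geq k_r\geq1}\prod_{j}(2k_j-1)^{-s_j}$ for an index with $s_1>1$; $\{1\}^d$ is $1$ repeated $d$ times. Alternating multiple $t$-values: $t(\boldsymbol{s};\boldsymbol{\sigma})=\sum_{k_1>\cdots>k_r\geq1}\prod_{j}\frac{\sigma_j^{k_j}}{(2k_j-1)^{s_j}}$, where a bar over $s_j$ means $\sigma_j=-1$ and no bar means $\sigma_j=1$ (here only the last argument carries sign $-1$). *)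

theory Defs
  imports Complex_Main
begin

fun tstar_trunc :: "nat list \<Rightarrow> nat \<Rightarrow> real" where
  "tstar_trunc [] N = 1"
| "tstar_trunc (s # ss) N =
     (\<Sum>k=1..N. inverse (real (2*k - 1) ^ s) * tstar_trunc ss k)"

definition tstar :: "nat list \<Rightarrow> real" where
  "tstar ss = lim (\<lambda>N. tstar_trunc ss N)"

fun tval_trunc :: "(nat \<times> real) list \<Rightarrow> nat \<Rightarrow> real" where
  "tval_trunc [] N = 1"
| "tval_trunc ((s, \<sigma>) # ss) N =
     (\<Sum>k=1..N. \<sigma> ^ k / real (2*k - 1) ^ s * tval_trunc ss (k - 1))"

definition tval :: "(nat \<times> real) list \<Rightarrow> real" where
  "tval ss = lim (\<lambda>N. tval_trunc ss N)"

definition compositions :: "nat \<Rightarrow> nat \<Rightarrow> nat list set" where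
  "compositions n r = {ss. length ss = r \<and> (\<forall>x\<in>set ss. 1 \<le> x) \<and> sum_list ss = n}"

text \<open>For (s_1,...,s_r), the index (s_1+2, s_2, ..., s_{r-1}, bar(s_r+2)):
  add 2 to the first and to the last entry (both to the single entry if r = 1,
  giving s_1+4), all signs +1 except the last one, which is -1.\<close>
definition idx47 :: "nat list \<Rightarrow> (nat \<times> real) list" where
  "idx47 ss = (let m = ss[0 := hd ss + 2];
                   m' = m[length m - 1 := last m + 2]
               in map (\<lambda>i. (m' ! i, if i = length m' - 1 then -1 else 1)) [0..<length m'])"

end

theory Submission
  imports Defs "HOL-Analysis.Gamma_Function" "HOL-Real_Asymp.Real_Asymp"
begin

text \<open>
  Write \<open>u\<^sub>k = 2k - 1\<close>. The partial fraction expansion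
  \<open>\<Prod>\<^sub>i\<^sub>\<le>\<^sub>n 1 / (1 - x\<^sup>2 / u\<^sub>i\<^sup>2) = \<Sum>\<^sub>k\<^sub>\<le>\<^sub>n c(n,k) / (1 - x\<^sup>2 / u\<^sub>k\<^sup>2)\<close> has coefficients
  \<open>c(n,k) = (-1)\<^sup>k\<^sup>-\<^sup>1 w(n,k)\<close> with \<open>w(n,k) > 0\<close>. Suppose a truncated star sum has the form
  \<open>f(n) = \<Sum>\<^sub>k\<^sub>\<le>\<^sub>n w(n,k) h(k)\<close>. Telescoping identities for \<open>w\<close> show that prepending the entry 2 to its
  index keeps this form and replaces \<open>h(k)\<close> by \<open>h(k) / u\<^sub>k\<^sup>2\<close>, and that prepending the entry 1 replaces
  \<open>h(j)\<close> by \<open>h(j) / u\<^sub>j + 2 \<Sum>\<^sub>k\<^sub><\<^sub>j h(k) / u\<^sub>k\<close>. The empty index corresponds to \<open>h(k) = (-1)\<^sup>k\<^sup>-\<^sup>1\<close>, because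
  \<open>\<Sum>\<^sub>k c(n,k) = 1\<close>. Iterating the second rule produces the sum over compositions, each strict inequality
  contributing a factor 2. By Wallis' product \<open>w(n,k)\<close> increases to \<open>4 / (\<pi> u\<^sub>k)\<close> as \<open>n\<close> grows, so
  dominated convergence gives the value of the infinite sum.
\<close>

section \<open>Partial fraction weights\<close>

text \<open>Truncated subtraction as in the truncated sums, so that unfolding matches them
  literally. The value at 0 is 0, hence the later hypotheses \<open>1 \<le> k\<close>.\<close>

definition onum :: "nat \<Rightarrow> real" where
  "onum k = real (2 * k - 1)"

text \<open>The closed form of \<open>\<bar>\<Prod>i\<in>{1..n} - {k}. u\<^sub>i\<^sup>2 / (u\<^sub>i\<^sup>2 - u\<^sub>k\<^sup>2)\<bar>\<close>.\<close>

definition pfw :: "nat \<Rightarrow> nat \<Rightarrow> real" where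
  "pfw n k = (if 1 \<le> k \<and> k \<le> n
     then 4 * (\<Prod>i=1..n. onum i)\<^sup>2 / (4 ^ n * onum k * fact (n - k) * fact (n + k - 1)) else 0)"

lemma onum_eq: "1 \<le> k \<Longrightarrow> onum k = 2 * real k - 1"
  by (auto simp: onum_def of_nat_diff)

lemma onum_Suc: "onum (Suc k) = 2 * real k + 1"
  by (simp add: onum_def)

lemma onum_ge: "1 \<le> k \<Longrightarrow> real k \<le> onum k"
  by (simp add: onum_eq)

lemma onum_pos: "1 \<le> k \<Longrightarrow> 0 < onum k"
  by (simp add: onum_eq)

lemma onum_nonzero: "1 \<le> k \<Longrightarrow> onum k \<noteq> 0"
  using onum_pos[of k] by simp

lemma pfw_eq_0: "n < k \<Longrightarrow> pfw n k = 0"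
  by (simp add: pfw_def)

lemma pfw_nonneg: "0 \<le> pfw n k"
  by (auto simp: pfw_def onum_def)

text \<open>Only \<open>onum k\<close> and the two factorials change with \<open>k\<close>, so
  neighbouring weights have a rational ratio. The cross-multiplied form also covers
  \<open>k = n\<close>, where both sides vanish.\<close>

lemma pfw_Suc_right:
  assumes "1 \<le> k" "k \<le> n"
  shows "(real n + real k) * onum (Suc k) * pfw n (Suc k) = (real n - real k) * onum k * pfw n k"
proof (cases "k = n")
  case True
  then show ?thesis by (simp add: pfw_def)
next
  case False
  \<comment> \<open>These substitutions remove every truncated subtraction, so that
    \<open>fact_Suc\<close> applies.\<close>
  obtain i where i: "k = Suc i" using assms by (cases k) auto
  obtain m where m: "n = Suc (k + m)" using assms False by (metis less_imp_Suc_add le_neq_implies_less)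
  define P where "P = 4 * (\<Prod>i=1..n. onum i)\<^sup>2 / 4 ^ n"
  have ix: "n - k = Suc m" "n + k - 1 = 2 * i + m + 2" "n - Suc k = m" "n + Suc k - 1 = Suc (2 * i + m + 2)"
    by (simp_all add: m i)
  have 1: "pfw n k = P / (onum k * fact (Suc m) * fact (2 * i + m + 2))"
    unfolding pfw_def ix P_def using assms by (simp add: mult.assoc del: fact_Suc)
  have 2: "pfw n (Suc k) = P / (onum (Suc k) * fact m * fact (Suc (2 * i + m + 2)))"
    unfolding pfw_def ix P_def using assms False by (simp add: mult.assoc del: fact_Suc)
  have "onum k > 0" "onum (Suc k) > 0" using assms by (simp_all add: onum_pos)
  moreover have "real n - real k = real (Suc m)" "real n + real k = real (Suc (2 * i + m + 2))"
    by (simp_all add: m i)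
  ultimately show ?thesis
    unfolding 1 2 fact_Suc by (simp add: divide_simps del: of_nat_Suc)
qed

text \<open>For \<open>k \<le> n\<close>, passing to \<open>Suc n\<close> multiplies the weight by
  \<open>(onum (Suc n))\<^sup>2 / ((onum (Suc n))\<^sup>2 - (onum k)\<^sup>2)\<close>, the new
  factor of the product. For \<open>k = Suc n\<close> the old weight is 0.\<close>

lemma pfw_Suc_left:
  assumes "1 \<le> k"
  shows "pfw (Suc n) k - pfw n k = pfw (Suc n) k * (onum k)\<^sup>2 / (onum (Suc n))\<^sup>2"
proof -
  consider "Suc n < k" | "k = Suc n" | "k \<le> n" by linarith
  then show ?thesis
  proof cases
    case 3
    obtain i where i: "k = Suc i" using assms by (cases k) auto
    obtain m where m: "n = k + m" using 3 by (metis le_add_diff_inverse)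
    define P where "P = 4 * (\<Prod>i=1..n. onum i)\<^sup>2 / 4 ^ n"
    have ix: "n - k = m" "n + k - 1 = 2 * i + m + 1" "Suc n - k = Suc m" "Suc n + k - 1 = Suc (2 * i + m + 1)"
      by (simp_all add: m i)
    have 1: "pfw n k = P / (onum k * fact m * fact (2 * i + m + 1))"
      unfolding pfw_def ix P_def using assms 3 by (simp add: mult.assoc del: fact_Suc)
    have 2: "pfw (Suc n) k = (P * (onum (Suc n))\<^sup>2 / 4) / (onum k * fact (Suc m) * fact (Suc (2 * i + m + 1)))"
      unfolding pfw_def ix P_def using assms 3
      by (simp add: mult.assoc power_mult_distrib mult.left_commute del: fact_Suc)
    have pos: "onum k > 0" "onum (Suc n) > 0" using assms by (simp_all add: onum_pos)
    have sq: "(onum (Suc n))\<^sup>2 - (onum k)\<^sup>2 = 4 * real (Suc m) * real (Suc (2 * i + m + 1))"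
      by (simp add: onum_Suc i m power2_eq_square algebra_simps)
    have "pfw (Suc n) k * ((onum (Suc n))\<^sup>2 - (onum k)\<^sup>2) = pfw n k * (onum (Suc n))\<^sup>2"
      using pos unfolding sq 1 2 fact_Suc by (simp add: divide_simps del: of_nat_Suc)
    then show ?thesis using pos by (simp add: field_simps)
  qed (use assms onum_pos[of "Suc n"] in \<open>auto simp: pfw_eq_0\<close>)
qed

section \<open>Summation identities for the weights\<close>

lemma sum_telescope_to_0:
  fixes X :: "nat \<Rightarrow> real"
  assumes "\<And>j. k \<le> j \<Longrightarrow> j \<le> n \<Longrightarrow> f j = X j - X (Suc j)" and "X (Suc n) = 0" "k \<le> Suc n"
  shows "(\<Sum>j=k..n. f j) = X k"
proof -
  have "(\<Sum>j=k..n. f j) = (\<Sum>j=k..n. X j - X (Suc j))"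
    using assms by (intro sum.cong) auto
  also have "\<dots> = - (\<Sum>j=k..n. X (Suc j) - X j)"
    by (simp add: sum_negf[symmetric])
  also have "\<dots> = X k" using assms by (subst sum_Suc_diff) auto
  finally show ?thesis .
qed

text \<open>The antidifference is \<open>(n + j - 1) * onum j * pfw n j\<close>: by
  \<open>pfw_Suc_right\<close> its successor is \<open>(n - j) * onum j * pfw n j\<close>, and the
  two coefficients differ by \<open>2 * j - 1\<close>.\<close>

lemma pfw_tail_sum:
  assumes "1 \<le> k" "k \<le> n"
  shows "(\<Sum>j=k..n. pfw n j * (onum j)\<^sup>2) = (real n + real k - 1) * onum k * pfw n k"
proof (rule sum_telescope_to_0)
  fix j assume j: "k \<le> j" "j \<le> n"
  then have *: "(real n + real j) * onum (Suc j) * pfw n (Suc j) = (real n - real j) * onum j * pfw n j"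
    using assms by (intro pfw_Suc_right) auto
  show "pfw n j * (onum j)\<^sup>2 = (real n + real j - 1) * onum j * pfw n j
      - (real n + real (Suc j) - 1) * onum (Suc j) * pfw n (Suc j)"
    using * j assms by (simp add: onum_eq power2_eq_square algebra_simps)
qed (use assms in \<open>auto simp: pfw_eq_0\<close>)

text \<open>Twice the tail sum minus its first term, with
  \<open>2 * (n + k - 1) - (2 * k - 1) = 2 * n - 1\<close>. The coefficients 1 and 2 are the kernel
  of \<open>star_op\<close>.\<close>

lemma pfw_kernel_sum:
  assumes "1 \<le> k" "k \<le> n"
  shows "(\<Sum>j=k..n. (if k = j then 1 else 2) * (pfw n j * (onum j)\<^sup>2)) = onum n * onum k * pfw n k"
proof -
  have "(\<Sum>j=k..n. (if k = j then 1 else 2) * (pfw n j * (onum j)\<^sup>2))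
      = (\<Sum>j=k..n. 2 * (pfw n j * (onum j)\<^sup>2) - (if k = j then pfw n j * (onum j)\<^sup>2 else 0))"
    by (intro sum.cong) auto
  also have "\<dots> = 2 * ((real n + real k - 1) * onum k * pfw n k) - pfw n k * (onum k)\<^sup>2"
    using assms by (simp add: sum_subtractf sum_distrib_left[symmetric] pfw_tail_sum)
  also have "\<dots> = onum n * onum k * pfw n k"
    using assms by (simp add: onum_eq power2_eq_square algebra_simps)
  finally show ?thesis .
qed

text \<open>The antidifference used here comes from Gosper's algorithm; it vanishes at both ends.\<close>

lemma pfw_alternating_square_sum:
  assumes "2 \<le> n"
  shows "(\<Sum>k=1..n. pfw n k * (onum k)\<^sup>2 * (-1) ^ (k - 1)) = 0"
proof -
  \<comment> \<open>The factor \<open>n - 1\<close> clears the denominator of the antidifference and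
    is cancelled at the end. For \<open>n = 1\<close> the sum is 1, not 0.\<close>
  have "(\<Sum>k=1..n. (real n - 1) * (pfw n k * (onum k)\<^sup>2 * (-1) ^ (k - 1)))
      = (-1) ^ (1 - 1) * (real 1 - 1) * (real n + real 1 - 1) * onum 1 * pfw n 1"
  proof (rule sum_telescope_to_0[where
        X = "\<lambda>j. (-1) ^ (j - 1) * (real j - 1) * (real n + real j - 1) * onum j * pfw n j"])
    fix j assume j: "1 \<le> j" "j \<le> n"
    then have *: "(real n + real j) * onum (Suc j) * pfw n (Suc j) = (real n - real j) * onum j * pfw n j"
      by (intro pfw_Suc_right)
    have "(-1) ^ j * real j * ((real n + real j) * onum (Suc j) * pfw n (Suc j))
        = - ((-1) ^ (j - 1)) * real j * ((real n - real j) * onum j * pfw n j)"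
      unfolding * using j by (cases j) auto
    then show "(real n - 1) * (pfw n j * (onum j)\<^sup>2 * (-1) ^ (j - 1))
      = (-1) ^ (j - 1) * (real j - 1) * (real n + real j - 1) * onum j * pfw n j
      - (-1) ^ (Suc j - 1) * (real (Suc j) - 1) * (real n + real (Suc j) - 1) * onum (Suc j) * pfw n (Suc j)"
      using j by (simp add: onum_eq power2_eq_square algebra_simps)
  qed (auto simp: pfw_eq_0)
  then show ?thesis using assms by (simp add: sum_distrib_left[symmetric])
qed

text \<open>\<open>pfw_Suc_left\<close> summed termwise, the shorter sum being extended by a
  vanishing term. It reduces inductions on \<open>n\<close> to sums weighted with squares.\<close>

lemma sum_pfw_Suc_diff:
  "(\<Sum>k=1..Suc n. pfw (Suc n) k * h k) - (\<Sum>k=1..n. pfw n k * h k)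
    = (\<Sum>k=1..Suc n. pfw (Suc n) k * (onum k)\<^sup>2 * h k) / (onum (Suc n))\<^sup>2"
proof -
  have "(\<Sum>k=1..n. pfw n k * h k) = (\<Sum>k=1..Suc n. pfw n k * h k)"
    by (simp add: pfw_eq_0)
  then have "(\<Sum>k=1..Suc n. pfw (Suc n) k * h k) - (\<Sum>k=1..n. pfw n k * h k)
      = (\<Sum>k=1..Suc n. (pfw (Suc n) k - pfw n k) * h k)"
    by (simp only: sum_subtractf left_diff_distrib)
  also have "\<dots> = (\<Sum>k=1..Suc n. pfw (Suc n) k * (onum k)\<^sup>2 * h k / (onum (Suc n))\<^sup>2)"
    by (intro sum.cong) (auto simp: pfw_Suc_left)
  finally show ?thesis by (simp only: sum_divide_distrib)
qed

text \<open>The partial fraction expansion at x = 0. The sum is 1 at \<open>n = 1\<close> and stays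
  constant because the alternating square sum vanishes.\<close>

lemma pfw_alternating_sum:
  assumes "1 \<le> n"
  shows "(\<Sum>k=1..n. pfw n k * (-1) ^ (k - 1)) = 1"
  using assms
proof (induction n rule: dec_induct)
  case base
  show ?case by (simp add: pfw_def onum_def)
next
  case (step n)
  then show ?case
    using sum_pfw_Suc_diff[of n "\<lambda>k. (-1) ^ (k - 1)"] pfw_alternating_square_sum[of "Suc n"] by simp
qed

section \<open>Truncated star sums\<close>

definition star_op :: "(nat \<Rightarrow> real) \<Rightarrow> nat \<Rightarrow> real" where
  "star_op h j = (\<Sum>k=1..j. (if k = j then 1 else 2) * (h k / onum k))"

text \<open>After exchanging the triangular double sum, the inner sum over \<open>j\<close> is
  \<open>pfw_kernel_sum\<close>, whose factor \<open>onum k\<close> cancels the denominator in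
  \<open>star_op\<close>.\<close>

lemma sum_pfw_star_op_square:
  "(\<Sum>j=1..n. pfw n j * (onum j)\<^sup>2 * star_op h j) = onum n * (\<Sum>k=1..n. pfw n k * h k)"
proof -
  have "(\<Sum>j=1..n. pfw n j * (onum j)\<^sup>2 * star_op h j)
      = (\<Sum>j=1..n. \<Sum>k=1..j. (if k = j then 1 else 2) * (pfw n j * (onum j)\<^sup>2) * (h k / onum k))"
    by (simp add: star_op_def sum_distrib_left mult_ac)
  also have "\<dots> = (\<Sum>k=1..n. \<Sum>j=k..n. (if k = j then 1 else 2) * (pfw n j * (onum j)\<^sup>2) * (h k / onum k))"
    unfolding sum.Sigma[OF finite_atLeastAtMost ballI[OF finite_atLeastAtMost]]
    by (rule sum.reindex_bij_witness[of _ "\<lambda>(a, b). (b, a)" "\<lambda>(a, b). (b, a)"]) auto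
  also have "\<dots> = (\<Sum>k=1..n. onum n * onum k * pfw n k * (h k / onum k))"
    by (intro sum.cong refl) (simp only: sum_distrib_right[symmetric] atLeastAtMost_iff pfw_kernel_sum)
  also have "\<dots> = onum n * (\<Sum>k=1..n. pfw n k * h k)"
    by (auto simp: sum_distrib_left onum_nonzero intro!: sum.cong)
  finally show ?thesis .
qed

text \<open>The rule for a prepended entry 1: in the increment of the right side,
  \<open>sum_pfw_star_op_square\<close> cancels one power of \<open>onum (Suc N)\<close>.\<close>

lemma sum_star_one:
  "(\<Sum>n=1..N. (\<Sum>k=1..n. pfw n k * h k) / onum n) = (\<Sum>k=1..N. pfw N k * star_op h k)"
proof (induction N)
  case (Suc N)
  have "(\<Sum>k=1..Suc N. pfw (Suc N) k * star_op h k) - (\<Sum>k=1..N. pfw N k * star_op h k)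
      = (\<Sum>k=1..Suc N. pfw (Suc N) k * h k) / onum (Suc N)"
    unfolding sum_pfw_Suc_diff sum_pfw_star_op_square by (simp add: power2_eq_square onum_nonzero)
  then show ?case using Suc by simp
qed simp

text \<open>The rule for a prepended entry 2: in the increment of the right side,
  \<open>(onum k)\<^sup>2\<close> cancels inside the sum.\<close>

lemma sum_star_two:
  "(\<Sum>n=1..N. (\<Sum>k=1..n. pfw n k * h k) / (onum n)\<^sup>2) = (\<Sum>k=1..N. pfw N k * (h k / (onum k)\<^sup>2))"
proof (induction N)
  case (Suc N)
  have "(\<Sum>k=1..Suc N. pfw (Suc N) k * (h k / (onum k)\<^sup>2)) - (\<Sum>k=1..N. pfw N k * (h k / (onum k)\<^sup>2))
      = (\<Sum>k=1..Suc N. pfw (Suc N) k * h k) / (onum (Suc N))\<^sup>2"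
    unfolding sum_pfw_Suc_diff
    by (intro arg_cong[of _ _ "\<lambda>x. x / _"] sum.cong) (auto simp: onum_nonzero)
  then show ?case using Suc by simp
qed simp

text \<open>The coefficients of the index \<open>[2]\<close>, obtained from those of the empty index
  by the rule for 2.\<close>

definition alt_sq :: "nat \<Rightarrow> real" where
  "alt_sq k = (-1) ^ (k - 1) / (onum k)\<^sup>2"

lemma tstar_trunc_ones_two:
  "tstar_trunc (replicate d 1 @ [2]) N = (\<Sum>k=1..N. pfw N k * (star_op ^^ d) alt_sq k)"
proof (induction d arbitrary: N)
  case 0
  have "tstar_trunc [2] N = (\<Sum>n=1..N. (\<Sum>k=1..n. pfw n k * (-1) ^ (k - 1)) / (onum n)\<^sup>2)"
    using pfw_alternating_sum by (auto simp: onum_def inverse_eq_divide intro!: sum.cong)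
  then show ?case by (simp only: sum_star_two alt_sq_def funpow.simps id_apply replicate.simps append.simps)
next
  case (Suc d)
  have "tstar_trunc (replicate (Suc d) 1 @ [2]) N
      = (\<Sum>n=1..N. (\<Sum>k=1..n. pfw n k * (star_op ^^ d) alt_sq k) / onum n)"
    using Suc by (simp add: onum_def inverse_eq_divide del: One_nat_def)
  then show ?case by (simp only: sum_star_one funpow.simps comp_apply)
qed

lemma tstar_trunc_two_ones_two:
  "tstar_trunc (2 # replicate d 1 @ [2]) N = (\<Sum>k=1..N. pfw N k * ((star_op ^^ d) alt_sq k / (onum k)\<^sup>2))"
proof -
  have "tstar_trunc (2 # replicate d 1 @ [2]) N
      = (\<Sum>n=1..N. (\<Sum>k=1..n. pfw n k * (star_op ^^ d) alt_sq k) / (onum n)\<^sup>2)"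
    by (simp add: tstar_trunc_ones_two onum_def inverse_eq_divide del: One_nat_def)
  then show ?thesis by (simp only: sum_star_two)
qed

section \<open>Passage to the limit\<close>

text \<open>Wallis' partial products tend to \<open>pi / 2\<close> and the last factor tends to 2,
  so the first weight tends to \<open>4 / pi\<close>.\<close>

lemma pfw_first_eq:
  "pfw (Suc n) 1 = inverse (\<Prod>k=1..n. (4*real k^2) / (4*real k^2 - 1)) * ((2 * real n + 1) / (real n + 1))"
proof (induction n)
  case 0
  show ?case by (simp add: pfw_def onum_def)
next
  case (Suc n)
  have *: "pfw (Suc (Suc n)) 1 * ((onum (Suc (Suc n)))\<^sup>2 - 1) = pfw (Suc n) 1 * (onum (Suc (Suc n)))\<^sup>2"
    using pfw_Suc_left[of 1 "Suc n"] onum_pos[of "Suc (Suc n)"] by (simp add: onum_eq[of 1] field_simps del: One_nat_def)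
  have nz: "(onum (Suc (Suc n)))\<^sup>2 - 1 = 4 * (real n + 1) * (real n + 2)"
    by (simp add: onum_Suc power2_eq_square algebra_simps)
  have "pfw (Suc (Suc n)) 1 = pfw (Suc n) 1 * (2 * real n + 3)\<^sup>2 / (4 * (real n + 1) * (real n + 2))"
    using * unfolding nz by (intro eq_divide_imp) (auto simp: onum_Suc add_ac)
  moreover have "(2 * real n + 1) / (real n + 1) * ((2 * real n + 3)\<^sup>2 / (4 * (real n + 1) * (real n + 2)))
      = inverse ((4 * (real n + 1)\<^sup>2) / (4 * (real n + 1)\<^sup>2 - 1)) * ((2 * real n + 3) / (real n + 2))"
  proof -
    have f: "4 * (real n + 1)\<^sup>2 - 1 = (2 * real n + 1) * (2 * real n + 3)"
      by (simp add: power2_eq_square algebra_simps)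
    show ?thesis unfolding f by (simp add: divide_simps power2_eq_square)
  qed
  moreover have "(\<Prod>k=1..Suc n. (4*real k^2) / (4*real k^2 - 1))
      = (\<Prod>k=1..n. (4*real k^2) / (4*real k^2 - 1)) * ((4 * (real n + 1)\<^sup>2) / (4 * (real n + 1)\<^sup>2 - 1))"
    by (simp add: add_ac)
  moreover have "(2 * real (Suc n) + 1) / (real (Suc n) + 1) = (2 * real n + 3) / (real n + 2)"
    by (simp add: add_ac)
  ultimately show ?case
    by (simp only: Suc inverse_mult_distrib mult.assoc times_divide_eq_right[symmetric])
qed

lemma pfw_first_tendsto: "(\<lambda>n. pfw n 1) \<longlonglongrightarrow> 4 / pi"
proof -
  have "(\<lambda>n. (2 * real n + 1) / (real n + 1)) \<longlonglongrightarrow> 2" by real_asymp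
  from tendsto_mult[OF tendsto_inverse[OF wallis] this]
  have "(\<lambda>n. pfw (Suc n) 1) \<longlonglongrightarrow> 4 / pi"
    by (simp add: pfw_first_eq del: One_nat_def)
  then show ?thesis by (rule LIMSEQ_imp_Suc)
qed

text \<open>By \<open>pfw_Suc_right\<close> the step from \<open>k\<close> to \<open>Suc k\<close>
  multiplies the limit by \<open>onum k / onum (Suc k)\<close>, so Wallis' product enters only
  through \<open>k = 1\<close>.\<close>

lemma pfw_tendsto:
  assumes "1 \<le> k"
  shows "(\<lambda>n. pfw n k) \<longlonglongrightarrow> 4 / (pi * onum k)"
  using assms
proof (induction k rule: dec_induct)
  case base
  show ?case using pfw_first_tendsto by (simp add: onum_def)
next
  case (step k)
  have "(\<lambda>n. (real n - real k) / (real n + real k)) \<longlonglongrightarrow> 1" by real_asymp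
  from tendsto_mult[OF tendsto_mult[OF this step.IH] tendsto_const[of "onum k / onum (Suc k)"]]
  have "(\<lambda>n. (real n - real k) / (real n + real k) * pfw n k * (onum k / onum (Suc k)))
      \<longlonglongrightarrow> 4 / (pi * onum (Suc k))"
    using onum_nonzero[of k] step by simp
  then show ?case
  proof (rule Lim_transform_eventually)
    show "\<forall>\<^sub>F n in sequentially. (real n - real k) / (real n + real k) * pfw n k * (onum k / onum (Suc k)) = pfw n (Suc k)"
      using eventually_ge_at_top[of k]
    proof eventually_elim
      case (elim n)
      moreover have "0 < (real n + real k) * onum (Suc k)"
        using step elim by (simp add: onum_pos)
      ultimately show ?case using pfw_Suc_right[of k n] step onum_pos[of "Suc k"]
        by (simp add: divide_eq_eq mult_ac)
    qed
  qed
qed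

text \<open>By \<open>pfw_Suc_left\<close> the weights increase with \<open>n\<close>, so their
  limit bounds them. This is the dominating bound for Tannery's theorem.\<close>

lemma pfw_le:
  assumes "1 \<le> k"
  shows "pfw n k \<le> 4 / (pi * onum k)"
proof -
  have "incseq (\<lambda>n. pfw n k)"
  proof (rule incseq_SucI)
    fix n
    have "0 \<le> pfw (Suc n) k * (onum k)\<^sup>2 / (onum (Suc n))\<^sup>2" by (simp add: pfw_nonneg)
    then show "pfw n k \<le> pfw (Suc n) k" using pfw_Suc_left[OF assms, of n] by simp
  qed
  then show ?thesis using pfw_tendsto[OF assms] by (rule incseq_le)
qed

lemma sum_pfw_tendsto:
  assumes "summable (\<lambda>k. \<bar>h (Suc k)\<bar> / onum (Suc k))"
  shows "(\<lambda>n. \<Sum>k=1..n. pfw n k * h k) \<longlonglongrightarrow> 4 / pi * (\<Sum>k. h (Suc k) / onum (Suc k))"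
proof -
  let ?a = "\<lambda>k n. pfw n (Suc k) * h (Suc k)"
  have "(\<lambda>n. \<Sum>k. ?a k n) \<longlonglongrightarrow> (\<Sum>k. 4 / (pi * onum (Suc k)) * h (Suc k))"
  proof (rule tannerys_theorem[THEN conjunct2, THEN conjunct2])
    show "((\<lambda>n. ?a k n) \<longlongrightarrow> 4 / (pi * onum (Suc k)) * h (Suc k)) sequentially" for k
      by (intro tendsto_mult pfw_tendsto tendsto_const) simp
    show "summable (\<lambda>k. 4 / pi * (\<bar>h (Suc k)\<bar> / onum (Suc k)))"
      using assms by (rule summable_mult)
    show "\<forall>\<^sub>F (k, n) in sequentially \<times>\<^sub>F sequentially. norm (?a k n) \<le> 4 / pi * (\<bar>h (Suc k)\<bar> / onum (Suc k))"
    proof (intro always_eventually allI, safe)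
      fix k n :: nat
      have "pfw n (Suc k) * \<bar>h (Suc k)\<bar> \<le> 4 / (pi * onum (Suc k)) * \<bar>h (Suc k)\<bar>"
        by (intro mult_right_mono pfw_le) auto
      then show "norm (?a k n) \<le> 4 / pi * (\<bar>h (Suc k)\<bar> / onum (Suc k))"
        by (simp add: abs_mult pfw_nonneg)
    qed
  qed simp
  moreover have "(\<Sum>k. ?a k n) = (\<Sum>k=1..n. pfw n k * h k)" for n
  proof -
    have "(\<Sum>k. ?a k n) = (\<Sum>k<n. ?a k n)"
      by (rule suminf_finite) (auto simp: pfw_eq_0)
    also have "\<dots> = (\<Sum>k=1..n. pfw n k * h k)"
      by (rule sum.reindex_bij_witness[of _ "\<lambda>k. k - 1" Suc]) auto
    finally show ?thesis .
  qed
  moreover have "(\<Sum>k. 4 / (pi * onum (Suc k)) * h (Suc k)) = 4 / pi * (\<Sum>k. h (Suc k) / onum (Suc k))"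
  proof -
    have "summable (\<lambda>k. \<bar>h (Suc k) / onum (Suc k)\<bar>)"
      using assms by (simp add: onum_def)
    then have "summable (\<lambda>k. h (Suc k) / onum (Suc k))" by (rule summable_rabs_cancel)
    from suminf_mult[OF this, of "4 / pi"] show ?thesis by simp
  qed
  ultimately show ?thesis by simp
qed

section \<open>Growth estimates\<close>

text \<open>The terms are at most \<open>1 / sqrt k\<close>, which is compared with the increment of
  \<open>2 * sqrt k\<close>. The result is again of square root order, so nested summation preserves
  such bounds.\<close>

lemma sum_sqrt_div_onum_le:
  "(\<Sum>k=1..n. sqrt (real k) / onum k) \<le> 2 * sqrt (real n)"
proof (induction n)
  case (Suc n)
  have "sqrt (real (Suc n)) / onum (Suc n) \<le> sqrt (real (Suc n)) / real (Suc n)"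
    using onum_ge[of "Suc n"] by (intro divide_left_mono) (auto simp: onum_pos)
  also have "\<dots> = 1 / sqrt (real (Suc n))" by (rule sqrt_divide_self_eq[THEN trans]) (auto simp: inverse_eq_divide)
  also have "\<dots> \<le> 2 * sqrt (real (Suc n)) - 2 * sqrt (real n)"
  proof -
    define a b where "a = sqrt (real (Suc n))" and "b = sqrt (real n)"
    have "a > 0" "a\<^sup>2 = real n + 1" "b\<^sup>2 = real n" by (auto simp: a_def b_def)
    \<comment> \<open>Expanding the square with \<open>a\<^sup>2 = b\<^sup>2 + 1\<close> yields
      \<open>1 \<le> 2 * a * (a - b)\<close>.\<close>
    moreover have "0 \<le> (a - b)\<^sup>2" by simp
    ultimately have "1 \<le> (2 * a - 2 * b) * a" by (simp add: power2_eq_square algebra_simps)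
    then show ?thesis using \<open>a > 0\<close> unfolding a_def[symmetric] b_def[symmetric]
      by (simp add: field_simps)
  qed
  finally show ?case using Suc by simp
qed simp

lemma abs_sum_div_onum_le:
  assumes "\<And>k. 1 \<le> k \<Longrightarrow> \<bar>f k\<bar> \<le> C * (sqrt (real k) / onum k)" and "0 \<le> C"
  shows "\<bar>\<Sum>k=1..n. f k\<bar> \<le> 2 * C * sqrt (real n)"
proof -
  have "\<bar>\<Sum>k=1..n. f k\<bar> \<le> (\<Sum>k=1..n. C * (sqrt (real k) / onum k))"
    using assms by (intro order_trans[OF sum_abs] sum_mono) auto
  also have "\<dots> \<le> C * (2 * sqrt (real n))"
    unfolding sum_distrib_left[symmetric] using assms by (intro mult_left_mono sum_sqrt_div_onum_le)
  finally show ?thesis by simp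
qed

lemma star_op_power_bound:
  "\<exists>C\<ge>0. \<forall>k\<ge>1. \<bar>(star_op ^^ d) alt_sq k\<bar> \<le> C * sqrt (real k)"
proof (induction d)
  case 0
  have "\<bar>alt_sq k\<bar> \<le> 1 * sqrt (real k)" if "1 \<le> k" for k
  proof -
    have "1 \<le> onum k" using onum_ge[OF that] that by simp
    then have "1 / (onum k)\<^sup>2 \<le> 1" by (simp add: field_simps)
    moreover have "1 \<le> sqrt (real k)" using that by simp
    ultimately have "1 / (onum k)\<^sup>2 \<le> sqrt (real k)" by (rule order_trans)
    then show ?thesis by (simp add: alt_sq_def power_abs)
  qed
  then show ?case by (intro exI[of _ 1]) auto
next
  case (Suc d)
  then obtain C where C: "C \<ge> 0" "\<And>k. k \<ge> 1 \<Longrightarrow> \<bar>(star_op ^^ d) alt_sq k\<bar> \<le> C * sqrt (real k)" by blast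
  \<comment> \<open>One factor 2 bounds the kernel of \<open>star_op\<close>; the other comes from
    \<open>abs_sum_div_onum_le\<close>.\<close>
  have "\<bar>star_op ((star_op ^^ d) alt_sq) j\<bar> \<le> 2 * (2 * C) * sqrt (real j)" for j
    unfolding star_op_def[of _ j]
  proof (rule abs_sum_div_onum_le)
    fix k :: nat assume k: "1 \<le> k"
    define x where "x = \<bar>(star_op ^^ d) alt_sq k\<bar> / onum k"
    have "0 \<le> x" using onum_pos[OF k] by (simp add: x_def)
    have "x \<le> C * sqrt (real k) / onum k"
      unfolding x_def using C(2)[OF k] onum_pos[OF k] by (intro divide_right_mono) auto
    moreover have "\<bar>(if k = j then 1 else 2) * ((star_op ^^ d) alt_sq k / onum k)\<bar> \<le> 2 * x"
    proof -
      have "\<bar>(star_op ^^ d) alt_sq k / onum k\<bar> = x" using onum_pos[OF k] by (simp add: x_def)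
      then show ?thesis using \<open>0 \<le> x\<close> unfolding abs_mult by auto
    qed
    ultimately show "\<bar>(if k = j then 1 else 2) * ((star_op ^^ d) alt_sq k / onum k)\<bar>
        \<le> 2 * C * (sqrt (real k) / onum k)" by simp
  qed (use C in auto)
  then show ?case using C by (intro exI[of _ "2 * (2 * C)"]) auto
qed

text \<open>Square root growth survives each further summation, even for entries 1. The bound uses
  \<open>Suc n\<close> because the empty index has value 1 already at \<open>n = 0\<close>.\<close>

lemma tval_trunc_bound:
  assumes "\<forall>(s, \<sigma>) \<in> set ss. 1 \<le> s \<and> \<bar>\<sigma>\<bar> \<le> 1"
  shows "\<exists>C\<ge>0. \<forall>n. \<bar>tval_trunc ss n\<bar> \<le> C * sqrt (real (Suc n))"
  using assms
proof (induction ss)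
  case Nil
  then show ?case by (intro exI[of _ 1]) auto
next
  case (Cons p ss)
  obtain s \<sigma> where p: "p = (s, \<sigma>)" by force
  from Cons obtain C where C: "C \<ge> 0" "\<And>n. \<bar>tval_trunc ss n\<bar> \<le> C * sqrt (real (Suc n))" by auto
  have s: "1 \<le> s" "\<bar>\<sigma>\<bar> \<le> 1" using Cons.prems by (auto simp: p)
  have "\<bar>tval_trunc (p # ss) n\<bar> \<le> 2 * C * sqrt (real n)" for n
    unfolding p tval_trunc.simps
  proof (rule abs_sum_div_onum_le)
    fix k :: nat assume k: "1 \<le> k"
    have "1 \<le> onum k" using onum_ge[OF k] k by simp
    have "\<bar>\<sigma> ^ k / real (2 * k - 1) ^ s\<bar> \<le> 1 / onum k"
    proof -
      have "\<bar>\<sigma>\<bar> ^ k \<le> 1" using s by (intro power_le_one) auto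
      moreover have "onum k \<le> onum k ^ s" using \<open>1 \<le> onum k\<close> s by (simp add: self_le_power)
      ultimately show ?thesis using \<open>1 \<le> onum k\<close>
        unfolding onum_def[symmetric] abs_divide power_abs by (intro frac_le) auto
    qed
    moreover have "\<bar>tval_trunc ss (k - 1)\<bar> \<le> C * sqrt (real k)" using C(2)[of "k - 1"] k by simp
    ultimately have "\<bar>\<sigma> ^ k / real (2 * k - 1) ^ s\<bar> * \<bar>tval_trunc ss (k - 1)\<bar> \<le> 1 / onum k * (C * sqrt (real k))"
      using onum_pos[OF k] by (intro mult_mono) auto
    then show "\<bar>\<sigma> ^ k / real (2 * k - 1) ^ s * tval_trunc ss (k - 1)\<bar> \<le> C * (sqrt (real k) / onum k)"
      by (simp add: abs_mult mult_ac)
  qed (rule C)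
  also have "2 * C * sqrt (real n) \<le> 2 * C * sqrt (real (Suc n))" for n
    using C(1) by (intro mult_left_mono) auto
  finally show ?case using C(1) by (intro exI[of _ "2 * C"]) simp
qed

lemma summable_sqrt_div_onum_cube:
  "summable (\<lambda>k. sqrt (real (Suc k)) / onum (Suc k) ^ 3)"
proof (rule summable_comparison_test)
  show "summable (\<lambda>k. 1 / (real (Suc k))\<^sup>2)"
    using inverse_power_summable[of 2, where 'a = real] by (subst summable_Suc_iff) (simp add: inverse_eq_divide)
  have "sqrt (real (Suc k)) / onum (Suc k) ^ 3 \<le> 1 / (real (Suc k))\<^sup>2" for k
  proof -
    have "sqrt (real (Suc k)) \<le> real (Suc k)"
      by (rule real_le_lsqrt) (auto simp: power2_eq_square)
    moreover have "real (Suc k) ^ 3 \<le> onum (Suc k) ^ 3" by (intro power_mono onum_ge) auto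
    ultimately have "sqrt (real (Suc k)) / onum (Suc k) ^ 3 \<le> real (Suc k) / real (Suc k) ^ 3"
      by (intro frac_le) auto
    also have "\<dots> = 1 / (real (Suc k))\<^sup>2"
      by (simp add: power3_eq_cube power2_eq_square del: of_nat_Suc)
    finally show ?thesis .
  qed
  then show "\<exists>N. \<forall>n\<ge>N. norm (sqrt (real (Suc n)) / onum (Suc n) ^ 3) \<le> 1 / (real (Suc n))\<^sup>2"
    by (auto simp: onum_def)
qed

lemma sum_from_1_tendsto:
  assumes "summable (\<lambda>k. f (Suc k) :: real)"
  shows "(\<lambda>n. \<Sum>k=1..n. f k) \<longlonglongrightarrow> (\<Sum>k. f (Suc k))"
proof -
  have "(\<Sum>k=1..n. f k) = (\<Sum>k<n. f (Suc k))" for n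
    by (rule sum.reindex_bij_witness[of _ Suc "\<lambda>k. k - 1"]) auto
  then show ?thesis using summable_LIMSEQ[OF assms] by simp
qed

text \<open>An outer exponent of at least 3 beats the square root growth of the inner sum. The first
  entry of \<open>idx47 ss\<close> is at least 3 for every composition \<open>ss\<close>.\<close>

lemma tval_trunc_convergent:
  assumes "3 \<le> s" "\<bar>\<sigma>\<bar> \<le> 1" "\<forall>(s, \<sigma>) \<in> set ss. 1 \<le> s \<and> \<bar>\<sigma>\<bar> \<le> 1"
  shows "convergent (tval_trunc ((s, \<sigma>) # ss))"
proof -
  obtain C where C: "C \<ge> 0" "\<And>n. \<bar>tval_trunc ss n\<bar> \<le> C * sqrt (real (Suc n))"
    using tval_trunc_bound[OF assms(3)] by blast
  define f where "f k = \<sigma> ^ k / onum k ^ s * tval_trunc ss (k - 1)" for k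
  have "summable (\<lambda>k. f (Suc k))"
  proof (rule summable_comparison_test)
    show "summable (\<lambda>k. C * (sqrt (real (Suc k)) / onum (Suc k) ^ 3))"
      by (intro summable_mult summable_sqrt_div_onum_cube)
    have "\<bar>f (Suc k)\<bar> \<le> C * (sqrt (real (Suc k)) / onum (Suc k) ^ 3)" for k
    proof -
      have "1 \<le> onum (Suc k)" by (simp add: onum_Suc)
      have "\<bar>\<sigma>\<bar> ^ Suc k \<le> 1" using assms by (intro power_le_one) auto
      moreover have "onum (Suc k) ^ 3 \<le> onum (Suc k) ^ s" using \<open>1 \<le> onum (Suc k)\<close> assms by (intro power_increasing)
      ultimately have "\<bar>\<sigma> ^ Suc k / onum (Suc k) ^ s\<bar> \<le> 1 / onum (Suc k) ^ 3" using \<open>1 \<le> onum (Suc k)\<close>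
        unfolding abs_divide power_abs by (intro frac_le) auto
      then have "\<bar>\<sigma> ^ Suc k / onum (Suc k) ^ s\<bar> * \<bar>tval_trunc ss k\<bar> \<le> 1 / onum (Suc k) ^ 3 * (C * sqrt (real (Suc k)))"
        using \<open>1 \<le> onum (Suc k)\<close> C by (intro mult_mono) auto
      then show ?thesis unfolding f_def abs_mult by (simp add: mult_ac)
    qed
    then show "\<exists>N. \<forall>n\<ge>N. norm (f (Suc n)) \<le> C * (sqrt (real (Suc n)) / onum (Suc n) ^ 3)" by auto
  qed
  moreover have "tval_trunc ((s, \<sigma>) # ss) = (\<lambda>n. \<Sum>k=1..n. f k)"
    unfolding f_def onum_def by (rule ext) simp
  ultimately show ?thesis
    using sum_from_1_tendsto unfolding convergent_def by metis
qed

section \<open>Expansion over compositions\<close>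

text \<open>\<open>idx47\<close> without the increase of the first entry, recursive for use in
  inductions. It describes what follows the head of an index with several entries.\<close>

fun bar_last :: "nat list \<Rightarrow> (nat \<times> real) list" where
  "bar_last [] = []"
| "bar_last [s] = [(s + 2, -1)]"
| "bar_last (s # t # ss) = (s, 1) # bar_last (t # ss)"

lemma length_bar_last [simp]: "length (bar_last ss) = length ss"
  by (induction ss rule: bar_last.induct) auto

lemma bar_last_nth:
  "i < length ss \<Longrightarrow> bar_last ss ! i =
    (if i = length ss - 1 then (ss ! i + 2, -1) else (ss ! i, 1))"
  by (induction ss arbitrary: i rule: bar_last.induct) (auto simp: nth_Cons split: nat.splits)

lemma idx47_singleton: "idx47 [s] = [(s + 4, -1)]"
  by (simp add: idx47_def)

lemma idx47_Cons_Cons: "idx47 (s # t # ss) = (s + 2, 1) # bar_last (t # ss)"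
proof (rule nth_equalityI)
  fix i assume "i < length (idx47 (s # t # ss))"
  then have i: "i < Suc (Suc (length ss))" by (simp add: idx47_def Let_def)
  show "idx47 (s # t # ss) ! i = ((s + 2, 1) # bar_last (t # ss)) ! i"
  proof (cases i)
    case 0
    then show ?thesis by (simp add: idx47_def Let_def del: upt_Suc)
  next
    case (Suc j)
    then have "((s + 2, 1) # bar_last (t # ss)) ! i = bar_last (t # ss) ! j" by simp
    also have "\<dots> = (if j = length ss then ((t # ss) ! j + 2, -1) else ((t # ss) ! j, 1))"
      using i Suc by (subst bar_last_nth) auto
    also have "\<dots> = idx47 (s # t # ss) ! i"
      using i Suc by (auto simp: idx47_def Let_def last_conv_nth nth_Cons simp del: upt_Suc split: nat.splits)
    finally show ?thesis ..
  qed
qed (simp add: idx47_def Let_def)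

text \<open>The contribution of the largest summation index \<open>k\<close> to the sum with index \<open>bar_last ss\<close>.\<close>

fun bar_term :: "nat list \<Rightarrow> nat \<Rightarrow> real" where
  "bar_term [] k = 0"
| "bar_term [s] k = (-1) ^ k / onum k ^ (s + 2)"
| "bar_term (s # t # ss) k = (\<Sum>j=1..k-1. bar_term (t # ss) j) / onum k ^ s"

lemma tval_trunc_bar_last:
  "ss \<noteq> [] \<Longrightarrow> tval_trunc (bar_last ss) N = (\<Sum>k=1..N. bar_term ss k)"
proof (induction ss arbitrary: N rule: bar_last.induct)
  case (3 s t ss)
  then show ?case by (simp add: onum_def)
qed (simp_all add: onum_def)

text \<open>The 2 added to the first entry divides the outermost term by
  \<open>(onum k)\<^sup>2\<close>. This includes singletons, where
  \<open>s + 4 = (s + 2) + 2\<close>.\<close>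

lemma tval_trunc_idx47:
  assumes "ss \<noteq> []"
  shows "tval_trunc (idx47 ss) N = (\<Sum>k=1..N. bar_term ss k / (onum k)\<^sup>2)"
proof (cases ss rule: bar_last.cases)
  case (2 s)
  have pow: "x ^ (s + 4) = x ^ (s + 2) * x\<^sup>2" for x :: real
    by (simp add: add.commute flip: power_add del: power_Suc add_2_eq_Suc')
  show ?thesis
    unfolding 2 idx47_singleton tval_trunc.simps bar_term.simps onum_def[symmetric] pow by simp
next
  case (3 s t ss')
  show ?thesis
    unfolding 3 idx47_Cons_Cons tval_trunc.simps bar_term.simps onum_def[symmetric] power_add
      tval_trunc_bar_last[OF list.distinct(2)] by simp
qed (use assms in simp)

lemma bar_term_Suc_hd: "bar_term (Suc s # ss) k = bar_term (s # ss) k / onum k"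
  by (cases ss) auto

lemma bar_term_Cons_1: "ss \<noteq> [] \<Longrightarrow> bar_term (1 # ss) k = (\<Sum>j=1..k-1. bar_term ss j) / onum k"
  by (cases ss) auto

lemma tval_trunc_idx47_convergent:
  assumes "\<forall>x\<in>set ss. 1 \<le> x" "ss \<noteq> []"
  shows "convergent (tval_trunc (idx47 ss))"
proof (cases ss rule: bar_last.cases)
  case (2 s)
  then show ?thesis unfolding 2 idx47_singleton by (intro tval_trunc_convergent) auto
next
  case (3 s t ss')
  have "set (bar_last us) \<subseteq> {(s, \<sigma>). 1 \<le> s \<and> \<bar>\<sigma>\<bar> \<le> 1}" if "\<forall>x\<in>set us. 1 \<le> x" for us
    using that by (induction us rule: bar_last.induct) auto
  from this[of "t # ss'"] show ?thesis
    using assms unfolding 3 idx47_Cons_Cons by (intro tval_trunc_convergent) auto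
qed (use assms in simp)

text \<open>Compositions of \<open>n + 2\<close> arise uniquely from those of \<open>n + 1\<close> by increasing the first part or by
  prepending a part 1, matching the two terms of \<open>star_op\<close>.\<close>

definition all_compositions :: "nat \<Rightarrow> nat list set" where
  "all_compositions n = {ss. (\<forall>x\<in>set ss. 1 \<le> x) \<and> sum_list ss = n}"

lemma all_compositions_nonempty_list: "ss \<in> all_compositions (Suc n) \<Longrightarrow> ss \<noteq> []"
  by (auto simp: all_compositions_def)

lemma all_compositions_1: "all_compositions (Suc 0) = {[1]}"
proof -
  have "ss = [1]" if "ss \<in> all_compositions (Suc 0)" for ss
  proof (cases ss rule: bar_last.cases)
    case (3 s t us)
    then show ?thesis using that by (auto simp: all_compositions_def)
  qed (use that in \<open>auto simp: all_compositions_def\<close>)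
  then show ?thesis by (auto simp: all_compositions_def)
qed

lemma all_compositions_Suc:
  "all_compositions (Suc (Suc n)) =
     (\<lambda>ss. Suc (hd ss) # tl ss) ` all_compositions (Suc n) \<union> (#) 1 ` all_compositions (Suc n)"
proof (intro equalityI subsetI)
  fix ss assume ss: "ss \<in> all_compositions (Suc (Suc n))"
  then obtain s us where us: "ss = s # us" using all_compositions_nonempty_list by (cases ss) auto
  show "ss \<in> (\<lambda>ss. Suc (hd ss) # tl ss) ` all_compositions (Suc n) \<union> (#) 1 ` all_compositions (Suc n)"
  proof (cases "s = 1")
    case True
    then show ?thesis using ss us by (auto simp: all_compositions_def)
  next
    case False
    then have "(s - 1) # us \<in> all_compositions (Suc n)" using ss us by (auto simp: all_compositions_def)
    moreover have "ss = Suc (hd ((s - 1) # us)) # tl ((s - 1) # us)"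
      using ss us False by (auto simp: all_compositions_def)
    ultimately show ?thesis by blast
  qed
next
  fix ss assume "ss \<in> (\<lambda>ss. Suc (hd ss) # tl ss) ` all_compositions (Suc n) \<union> (#) 1 ` all_compositions (Suc n)"
  then consider us where "us \<in> all_compositions (Suc n)" "ss = Suc (hd us) # tl us"
    | us where "us \<in> all_compositions (Suc n)" "ss = 1 # us" by blast
  then show "ss \<in> all_compositions (Suc (Suc n))"
  proof cases
    case (1 us)
    then obtain a vs where "us = a # vs" using all_compositions_nonempty_list by (cases us) auto
    then show ?thesis using 1 by (auto simp: all_compositions_def)
  qed (auto simp: all_compositions_def)
qed

lemma finite_all_compositions: "finite (all_compositions (Suc n))"
  by (induction n) (auto simp: all_compositions_1 all_compositions_Suc)

text \<open>The two images are disjoint, as first parts are at least 2 in one and equal to 1 in the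
  other. Both maps are injective on nonempty lists.\<close>

lemma sum_all_compositions_Suc:
  "(\<Sum>ss\<in>all_compositions (Suc (Suc n)). F ss :: real) =
     (\<Sum>ss\<in>all_compositions (Suc n). F (Suc (hd ss) # tl ss)) + (\<Sum>ss\<in>all_compositions (Suc n). F (1 # ss))"
proof -
  have "inj_on (\<lambda>ss. Suc (hd ss) # tl ss) (all_compositions (Suc n))"
    using all_compositions_nonempty_list by (auto intro!: inj_onI intro: list.expand)
  moreover have "(\<lambda>ss. Suc (hd ss) # tl ss) ` all_compositions (Suc n) \<inter> (#) 1 ` all_compositions (Suc n) = {}"
  proof -
    have "0 < hd ss" if "ss \<in> all_compositions (Suc n)" for ss
      using that all_compositions_nonempty_list[OF that] by (cases ss) (auto simp: all_compositions_def)
    then show ?thesis by fastforce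
  qed
  ultimately show ?thesis
    unfolding all_compositions_Suc
    by (simp add: sum.union_disjoint finite_all_compositions sum.reindex)
qed

lemma star_op_eq:
  "1 \<le> k \<Longrightarrow> star_op h k = h k / onum k + 2 * (\<Sum>j=1..k-1. h j / onum j)"
  by (cases k) (auto simp: star_op_def sum_distrib_left intro!: sum.cong)

text \<open>Increasing the first part divides by \<open>onum k\<close>; prepending 1 gives a strict
  inner sum, with a factor 2 from the extra part. These are the diagonal and off-diagonal parts of
  \<open>star_op\<close>. The minus sign is that between \<open>(-1) ^ k\<close> and
  \<open>(-1) ^ (k - 1)\<close>.\<close>

lemma sum_bar_term_compositions:
  "1 \<le> k \<Longrightarrow> (\<Sum>ss\<in>all_compositions (Suc n). 2 ^ length ss * bar_term ss k) =
     - 2 * (star_op ^^ n) alt_sq k / onum k"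
proof (induction n arbitrary: k)
  case 0
  then show ?case
    by (cases k) (simp_all add: all_compositions_1 alt_sq_def power2_eq_square power3_eq_cube)
next
  case (Suc n)
  let ?S = "\<lambda>k. \<Sum>ss\<in>all_compositions (Suc n). 2 ^ length ss * bar_term ss k"
  let ?h = "(star_op ^^ n) alt_sq"
  have "(\<Sum>ss\<in>all_compositions (Suc n). 2 ^ length (Suc (hd ss) # tl ss) * bar_term (Suc (hd ss) # tl ss) k)
      = ?S k / onum k"
    unfolding sum_divide_distrib
  proof (intro sum.cong refl)
    fix ss assume "ss \<in> all_compositions (Suc n)"
    then show "2 ^ length (Suc (hd ss) # tl ss) * bar_term (Suc (hd ss) # tl ss) k
        = 2 ^ length ss * bar_term ss k / onum k"
      using all_compositions_nonempty_list by (cases ss) (auto simp: bar_term_Suc_hd)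
  qed
  moreover have "(\<Sum>ss\<in>all_compositions (Suc n). 2 ^ length (1 # ss) * bar_term (1 # ss) k)
      = 2 * (\<Sum>j=1..k-1. ?S j) / onum k"
  proof -
    have "(\<Sum>ss\<in>all_compositions (Suc n). 2 ^ length (1 # ss) * bar_term (1 # ss) k)
      = (\<Sum>ss\<in>all_compositions (Suc n). \<Sum>j=1..k-1. 2 / onum k * (2 ^ length ss * bar_term ss j))"
      using all_compositions_nonempty_list
      by (intro sum.cong refl) (simp add: bar_term_Cons_1 sum_distrib_left sum_divide_distrib mult_ac del: One_nat_def)
    then show ?thesis by (subst (asm) sum.swap) (simp add: sum_distrib_left sum_divide_distrib)
  qed
  moreover have "(\<Sum>j=1..k-1. ?S j) = (\<Sum>j=1..k-1. - 2 * (?h j / onum j))"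
    using Suc.IH by (intro sum.cong) auto
  then have "(\<Sum>j=1..k-1. ?S j) = - 2 * (\<Sum>j=1..k-1. ?h j / onum j)"
    by (simp only: sum_distrib_left)
  ultimately show ?case
    using Suc.IH[of k] Suc.prems unfolding sum_all_compositions_Suc funpow.simps comp_apply star_op_eq[OF Suc.prems]
    by (simp add: field_simps onum_nonzero)
qed

text \<open>Parts are at least 1, so a composition of \<open>Suc n\<close> has between 1 and
  \<open>Suc n\<close> parts.\<close>

lemma sum_compositions_by_length:
  "(\<Sum>r=1..Suc n. \<Sum>ss\<in>compositions (Suc n) r. F r ss :: real) = (\<Sum>ss\<in>all_compositions (Suc n). F (length ss) ss)"
proof -
  have len: "length ss \<le> sum_list ss" if "\<forall>x\<in>set ss. 1 \<le> x" for ss :: "nat list"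
    using that by (induction ss) auto
  have "length ` all_compositions (Suc n) \<subseteq> {1..Suc n}"
    using len all_compositions_nonempty_list by (fastforce simp: all_compositions_def Suc_le_eq)
  from sum.group[OF finite_all_compositions _ this, of "\<lambda>ss. F (length ss) ss"]
  have "(\<Sum>ss\<in>all_compositions (Suc n). F (length ss) ss)
      = (\<Sum>r=1..Suc n. \<Sum>ss\<in>{ss \<in> all_compositions (Suc n). length ss = r}. F (length ss) ss)" by simp
  also have "\<dots> = (\<Sum>r=1..Suc n. \<Sum>ss\<in>compositions (Suc n) r. F r ss)"
    by (intro sum.cong) (auto simp: compositions_def all_compositions_def)
  finally show ?thesis ..
qed

section \<open>Comparison of the two limits\<close>

theorem theorem4p7:
  fixes d :: nat
  shows "tstar (2 # replicate d 1 @ [2]) =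
    - (2 / pi) * (\<Sum>r=1..d+1. 2 ^ r * (\<Sum>ss\<in>compositions (d+1) r. tval (idx47 ss)))"
proof -
  let ?h = "(star_op ^^ d) alt_sq"
  let ?A = "all_compositions (Suc d)"
  \<comment> \<open>The common summand: the star value is \<open>4 / pi\<close> times its series,
    the sum over compositions is -2 times it.\<close>
  define f where "f k = ?h k / (onum k)\<^sup>2 / onum k" for k
  obtain C where C: "C \<ge> 0" "\<And>k. k \<ge> 1 \<Longrightarrow> \<bar>?h k\<bar> \<le> C * sqrt (real k)"
    using star_op_power_bound by blast
  have "summable (\<lambda>k. \<bar>f (Suc k)\<bar>)"
  proof (rule summable_comparison_test)
    show "summable (\<lambda>k. C * (sqrt (real (Suc k)) / onum (Suc k) ^ 3))"
      by (intro summable_mult summable_sqrt_div_onum_cube)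
    have "\<bar>f (Suc k)\<bar> \<le> C * (sqrt (real (Suc k)) / onum (Suc k) ^ 3)" for k
    proof -
      have "0 < onum (Suc k)" by (simp add: onum_pos)
      then have "\<bar>f (Suc k)\<bar> = \<bar>?h (Suc k)\<bar> / onum (Suc k) ^ 3"
        by (simp add: f_def abs_divide power2_eq_square power3_eq_cube)
      also have "\<dots> \<le> C * sqrt (real (Suc k)) / onum (Suc k) ^ 3"
        using C(2)[of "Suc k"] \<open>0 < onum (Suc k)\<close> by (intro divide_right_mono) auto
      finally show ?thesis by simp
    qed
    then show "\<exists>N. \<forall>n\<ge>N. norm \<bar>f (Suc n)\<bar> \<le> C * (sqrt (real (Suc n)) / onum (Suc n) ^ 3)" by auto
  qed
  moreover have "\<bar>f (Suc k)\<bar> = \<bar>?h (Suc k) / (onum (Suc k))\<^sup>2\<bar> / onum (Suc k)" for k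
    by (simp add: f_def abs_divide onum_def)
  ultimately have "summable (\<lambda>k. \<bar>?h (Suc k) / (onum (Suc k))\<^sup>2\<bar> / onum (Suc k))"
    by (simp only:)
  from sum_pfw_tendsto[OF this]
  have "(\<lambda>n. \<Sum>k=1..n. pfw n k * (?h k / (onum k)\<^sup>2)) \<longlonglongrightarrow> 4 / pi * (\<Sum>k. f (Suc k))"
    unfolding f_def .
  then have left: "tstar (2 # replicate d 1 @ [2]) = 4 / pi * (\<Sum>k. f (Suc k))"
    unfolding tstar_def tstar_trunc_two_ones_two by (rule limI)

  have "(\<lambda>N. \<Sum>ss\<in>?A. 2 ^ length ss * tval_trunc (idx47 ss) N) \<longlonglongrightarrow> (\<Sum>ss\<in>?A. 2 ^ length ss * tval (idx47 ss))"
    unfolding tval_def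
  proof (intro tendsto_sum tendsto_mult tendsto_const)
    fix ss assume ss: "ss \<in> ?A"
    have "convergent (tval_trunc (idx47 ss))"
      using ss all_compositions_nonempty_list[OF ss]
      by (intro tval_trunc_idx47_convergent) (auto simp: all_compositions_def)
    then show "tval_trunc (idx47 ss) \<longlonglongrightarrow> lim (tval_trunc (idx47 ss))"
      by (simp add: convergent_LIMSEQ_iff)
  qed
  \<comment> \<open>This identity is exact at every truncation \<open>N\<close>; no limit is
    involved.\<close>
  moreover have "(\<Sum>ss\<in>?A. 2 ^ length ss * tval_trunc (idx47 ss) N) = - 2 * (\<Sum>k=1..N. f k)" for N
  proof -
    have "(\<Sum>ss\<in>?A. 2 ^ length ss * tval_trunc (idx47 ss) N)
        = (\<Sum>ss\<in>?A. \<Sum>k=1..N. 2 ^ length ss * bar_term ss k / (onum k)\<^sup>2)"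
      using all_compositions_nonempty_list
      by (intro sum.cong refl) (simp add: tval_trunc_idx47 sum_distrib_left)
    also have "\<dots> = (\<Sum>k=1..N. (\<Sum>ss\<in>?A. 2 ^ length ss * bar_term ss k) / (onum k)\<^sup>2)"
      by (subst sum.swap) (simp add: sum_divide_distrib)
    also have "\<dots> = (\<Sum>k=1..N. - 2 * f k)"
      by (intro sum.cong refl) (simp add: sum_bar_term_compositions f_def)
    finally show ?thesis by (simp only: sum_distrib_left)
  qed
  moreover have "(\<lambda>N. - 2 * (\<Sum>k=1..N. f k)) \<longlonglongrightarrow> - 2 * (\<Sum>k. f (Suc k))"
    using summable_rabs_cancel[OF \<open>summable (\<lambda>k. \<bar>f (Suc k)\<bar>)\<close>]
    by (intro tendsto_mult tendsto_const sum_from_1_tendsto)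
  ultimately have "(\<Sum>ss\<in>?A. 2 ^ length ss * tval (idx47 ss)) = - 2 * (\<Sum>k. f (Suc k))"
    using LIMSEQ_unique by simp blast
  moreover have "(\<Sum>r=1..d+1. 2 ^ r * (\<Sum>ss\<in>compositions (d+1) r. tval (idx47 ss)))
      = (\<Sum>ss\<in>?A. 2 ^ length ss * tval (idx47 ss))"
    using sum_compositions_by_length[where n = d and F = "\<lambda>r ss. 2 ^ r * tval (idx47 ss)"] by (simp add: sum_distrib_left)
  ultimately show ?thesis using left by simp
qed

end
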